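(* Let $\Bbbk$ be a field and $0\ne v\in\Bbbk$ with $[n]!\ne0$ in $\Bbbk$. Let $\alpha$ be a $1$-factor of length $n$, let $1\le i\le n-1$, write $\alpha=\alpha'\|(\alpha_i,\alpha_{i+1})\|\alpha''$, and let $w=w_i(\alpha)$ be the sum of the entries of $\alpha'$. If $\alpha_i\alpha_{i+1}=-1$, set $\beta=\alpha'\|(-\alpha_i,-\alpha_{i+1})\|\alpha''$. (a) If $w=0$ and $\alpha_i\alpha_{i+1}=-1$, then $e_i\mu(\alpha)=-(v+v^{-1})\mu(\alpha)$. (b) If $w>0$ then $$e_i\mu(\alpha)=\begin{cases}\frac{[w+2]}{[w+1]}\big(\mu(\beta)-\mu(\alpha)\big)&\text{if }(\alpha_i,\alpha_{i+1})=(1,-1),\\ \frac{[w]}{[w+1]}\big(\mu(\beta)-\mu(\alpha)\big)&\text{if }(\alpha_i,\alpha_{i+1})=(-1,1),\\ 0&\text{otherwise.}\end{cases}$$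
   Context: Quantum integers: for $k\ge0$, $[k]=\sum_{t=0}^{k-1}v^{k-1-2t}\in\Bbbk$, $[-k]=-[k]$, $[k]!=[1][2]\cdots[k]$, $[0]!=1$. $V$ is the two-dimensional space with basis $y_1,y_{-1}$ and operators $Fy_1=y_{-1}$, $Fy_{-1}=0$, $Ky_{\pm1}=v^{\pm1}y_{\pm1}$. On $V^{\otimes m}$, $F$ acts as $\sum_{j=1}^m1^{\otimes(j-1)}\otimes F\otimes(K^{-1})^{\otimes(m-j)}$; $y_{i_1}\otimes\cdots\otimes y_{i_m}$ ($i_j\in\{\pm1\}$) has weight $\sum_ji_j$. ($V^{\otimes0}=\Bbbk$, of weight $0$, with $F=0$.) For $b\in V^{\otimes(m-1)}$ of weight $i_b$, $\Phi_1(b)=b\otimes y_1$ and $\Phi_2(b)=[i_b]\,b\otimes y_{-1}-v^{i_b}Fb\otimes y_1$. A $1$-factor of length $l$ is a sequence $\alpha=(\alpha_1,\dots,\alpha_l)$ with $\alpha_i=\pm1$ and all partial sums $\alpha_1+\cdots+\alpha_i\ge0$. $\mu(\alpha)=\Upsilon_l\cdots\Upsilon_1(1)\in V^{\otimes l}$, where $\Upsilon_i=\Phi_1$ if $\alpha_i=1$ and $\Upsilon_i=\Phi_2$ if $\alpha_i=-1$. The symbol $\|$ denotes concatenation of sequences. The operator $e_i$ on $V^{\otimes n}$ acts in tensor positions $i,i+1$ by $y_1\otimes y_1\mapsto0$, $y_{-1}\otimes y_{-1}\mapsto0$, $y_1\otimes y_{-1}\mapsto-v^{-1}y_1\otimes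 y_{-1}+y_{-1}\otimes y_1$, $y_{-1}\otimes y_1\mapsto y_1\otimes y_{-1}-v\,y_{-1}\otimes y_1$, and as the identity in the other positions. (These operators give an action on $V^{\otimes n}$ of the Temperley--Lieb algebra $\mathrm{TL}_n(-(v+v^{-1}))$: $e_i^2=-(v+v^{-1})e_i$, $e_ie_je_i=e_i$ if $|i-j|=1$, $e_ie_j=e_je_i$ if $|i-j|>1$.) *)

theory Defs
  imports Main "HOL-Library.Function_Algebras"
begin

text \<open>For \<open>k < 0\<close> the quantum integer is \<open>[k] = -[-k]\<close>.\<close>

definition qint :: "'k::field \<Rightarrow> int \<Rightarrow> 'k" where
  "qint v k =
     (if 0 \<le> k then (\<Sum>t<nat k. v powi (k - 1 - 2 * int t))
      else - (\<Sum>t<nat (- k). v powi (- k - 1 - 2 * int t)))"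

definition qfact :: "'k::field \<Rightarrow> nat \<Rightarrow> 'k" where
  "qfact v n = (\<Prod>j=1..n. qint v (int j))"


text \<open>
  A vector of the m-th tensor power of V is given by its coordinates in the basis
  \<open>y\<^sub>s = y\<^bsub>s\<^sub>1\<^esub> \<otimes> \<dots> \<otimes> y\<^bsub>s\<^sub>m\<^esub>\<close>, where s runs over \<open>words m\<close>: it is a function on integer
  lists that vanishes outside \<open>words m\<close>. Addition, subtraction and 0 are pointwise.
\<close>

type_synonym 'k tensor = "int list \<Rightarrow> 'k"

definition words :: "nat \<Rightarrow> int list set" where
  "words m = {s. length s = m \<and> set s \<subseteq> {1, -1}}"

definition tensor_power :: "nat \<Rightarrow> 'k::field tensor set" where
  "tensor_power m = {x. \<forall>s. s \<notin> words m \<longrightarrow> x s = 0}"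

definition y :: "int list \<Rightarrow> 'k::field tensor" where
  "y s = (\<lambda>t. if t = s then 1 else 0)"

definition smul :: "'k::field \<Rightarrow> 'k tensor \<Rightarrow> 'k tensor"  (infixr "*\<^sub>v" 75) where
  "c *\<^sub>v x = (\<lambda>s. c * x s)"

text \<open>\<open>tensor_y x a\<close> is \<open>x \<otimes> y\<^sub>a\<close>.\<close>

definition tensor_y :: "'k::field tensor \<Rightarrow> int \<Rightarrow> 'k tensor" where
  "tensor_y x a = (\<lambda>s. if s \<noteq> [] \<and> last s = a then x (butlast s) else 0)"

text \<open>
  An operator A on V is given by its matrix, \<open>A y\<^sub>c = A 1 c y\<^sub>1 + A (-1) c y\<^bsub>-1\<^esub>\<close>, and
  \<open>tensor_op [A\<^sub>1, \<dots>, A\<^sub>m]\<close> is \<open>A\<^sub>1 \<otimes> \<dots> \<otimes> A\<^sub>m\<close>.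
\<close>

definition id_V :: "int \<Rightarrow> int \<Rightarrow> 'k::field" where
  "id_V r c = (if r = c then 1 else 0)"

definition F_V :: "int \<Rightarrow> int \<Rightarrow> 'k::field" where
  "F_V r c = (if c = 1 \<and> r = -1 then 1 else 0)"

definition Kinv_V :: "'k::field \<Rightarrow> int \<Rightarrow> int \<Rightarrow> 'k" where
  "Kinv_V v r c = (if r = c then v powi (- c) else 0)"

definition tensor_op :: "(int \<Rightarrow> int \<Rightarrow> 'k::field) list \<Rightarrow> 'k tensor \<Rightarrow> 'k tensor" where
  "tensor_op As x = (\<lambda>s. if s \<in> words (length As)
     then (\<Sum>t\<in>words (length As). (\<Prod>j<length As. (As ! j) (s ! j) (t ! j)) * x t)
     else 0)"

definition F_tensor :: "'k::field \<Rightarrow> nat \<Rightarrow> 'k tensor \<Rightarrow> 'k tensor" where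
  "F_tensor v m x =
     (\<Sum>j=1..m. tensor_op (replicate (j - 1) id_V @ [F_V] @ replicate (m - j) (Kinv_V v)) x)"

definition has_weight :: "nat \<Rightarrow> int \<Rightarrow> 'k::field tensor \<Rightarrow> bool" where
  "has_weight m i x \<longleftrightarrow> x \<in> tensor_power m \<and> (\<forall>s. x s \<noteq> 0 \<longrightarrow> sum_list s = i)"


definition \<Phi>\<^sub>1 :: "'k::field tensor \<Rightarrow> 'k tensor" where
  "\<Phi>\<^sub>1 b = tensor_y b 1"

text \<open>
  In \<open>\<Phi>\<^sub>2 v m i b\<close> the argument b is meant to be a vector of the m-th tensor power and of
  weight i.
\<close>

definition \<Phi>\<^sub>2 :: "'k::field \<Rightarrow> nat \<Rightarrow> int \<Rightarrow> 'k tensor \<Rightarrow> 'k tensor" where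
  "\<Phi>\<^sub>2 v m i b = qint v i *\<^sub>v tensor_y b (-1) - (v powi i) *\<^sub>v tensor_y (F_tensor v m b) 1"

definition one_factor :: "int list \<Rightarrow> bool" where
  "one_factor \<alpha> \<longleftrightarrow> set \<alpha> \<subseteq> {1, -1} \<and> (\<forall>i\<le>length \<alpha>. 0 \<le> sum_list (take i \<alpha>))"

text \<open>
  \<open>mu_upto v \<alpha> k\<close> is \<open>\<Upsilon>\<^sub>k \<cdots> \<Upsilon>\<^sub>1 (1)\<close>. It has weight \<open>\<alpha>\<^sub>1 + \<cdots> + \<alpha>\<^sub>k\<close> (lemma
  \<open>has_weight_mu_upto\<close> below), which is therefore the weight supplied to \<open>\<Phi>\<^sub>2\<close>.
\<close>

primrec mu_upto :: "'k::field \<Rightarrow> int list \<Rightarrow> nat \<Rightarrow> 'k tensor" where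
  "mu_upto v \<alpha> 0 = y []"
| "mu_upto v \<alpha> (Suc k) =
     (if \<alpha> ! k = 1 then \<Phi>\<^sub>1 (mu_upto v \<alpha> k)
      else \<Phi>\<^sub>2 v k (sum_list (take k \<alpha>)) (mu_upto v \<alpha> k))"

definition mu :: "'k::field \<Rightarrow> int list \<Rightarrow> 'k tensor" where
  "mu v \<alpha> = mu_upto v \<alpha> (length \<alpha>)"


text \<open>\<open>TL_basis v i s\<close> is \<open>e\<^sub>i y\<^sub>s\<close>; list positions are counted from 0.\<close>

definition TL_basis :: "'k::field \<Rightarrow> nat \<Rightarrow> int list \<Rightarrow> 'k tensor" where
  "TL_basis v i s =
     (if s ! (i - 1) = 1 \<and> s ! i = -1 then
        (- inverse v) *\<^sub>v y s + y (s[i - 1 := -1, i := 1])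
      else if s ! (i - 1) = -1 \<and> s ! i = 1 then
        y (s[i - 1 := 1, i := -1]) - v *\<^sub>v y s
      else 0)"

definition TL_e :: "'k::field \<Rightarrow> nat \<Rightarrow> nat \<Rightarrow> 'k tensor \<Rightarrow> 'k tensor" where
  "TL_e v n i x = (\<Sum>s\<in>words n. x s *\<^sub>v TL_basis v i s)"


lemma sum_tensor_apply: "(\<Sum>i\<in>A. f i) s = (\<Sum>i\<in>A. f i s)"
  for f :: "'i \<Rightarrow> 'k::field tensor"
  by (induction A rule: infinite_finite_induct) auto

lemma words_snoc: "s \<noteq> [] \<Longrightarrow> butlast s \<in> words m \<Longrightarrow> last s \<in> {1, -1} \<Longrightarrow> s \<in> words (Suc m)"
  by (cases s rule: rev_cases) (auto simp: words_def)

lemma has_weight_tensor_y: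
  assumes "has_weight m i b" "a \<in> {1, -1}"
  shows "has_weight (Suc m) (i + a) (tensor_y b a)"
proof -
  have "s \<in> words (Suc m) \<and> sum_list s = i + a" if "tensor_y b a s \<noteq> 0" for s
  proof -
    from that have s: "s \<noteq> []" "last s = a" "b (butlast s) \<noteq> 0"
      by (auto simp: tensor_y_def split: if_splits)
    with assms have "butlast s \<in> words m" "sum_list (butlast s) = i"
      by (auto simp: has_weight_def tensor_power_def)
    moreover have "sum_list s = sum_list (butlast s) + last s"
      using s(1) by (cases s rule: rev_cases) auto
    ultimately show ?thesis using s assms(2) by (auto intro: words_snoc)
  qed
  then show ?thesis by (auto simp: has_weight_def tensor_power_def)
qed

lemma has_weight_F_tensor:
  assumes "has_weight m i b"
  shows "has_weight m (i - 2) (F_tensor v m b)"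
proof -
  have "s \<in> words m \<and> sum_list s = i - 2" if nz: "F_tensor v m b s \<noteq> 0" for s
  proof -
    define As where "As j = replicate (j - 1) id_V @ [F_V] @ replicate (m - j) (Kinv_V v)" for j
    have "(\<Sum>j=1..m. tensor_op (As j) b s) \<noteq> 0"
      using nz by (simp add: F_tensor_def sum_tensor_apply As_def)
    then obtain j where j: "j \<in> {1..m}" "tensor_op (As j) b s \<noteq> 0"
      by (meson sum.neutral)
    have len: "length (As j) = m" using j(1) by (auto simp: As_def)
    have s: "s \<in> words m" using j(2) len by (auto simp: tensor_op_def split: if_splits)
    have "(\<Sum>t\<in>words m. (\<Prod>k<m. (As j ! k) (s ! k) (t ! k)) * b t) \<noteq> 0"
      using j(2) len s by (simp add: tensor_op_def)
    then obtain t where t: "t \<in> words m" "(\<Prod>k<m. (As j ! k) (s ! k) (t ! k)) * b t \<noteq> 0"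
      by (meson sum.neutral)
    have bt: "sum_list t = i" using t(2) assms by (auto simp: has_weight_def)
    have fac: "(As j ! k) (s ! k) (t ! k) \<noteq> 0" if "k < m" for k
      using t(2) that by (auto simp: prod_zero_iff)
    have rel: "s ! k = t ! k - (if k = j - 1 then 2 else 0)" if k: "k < m" for k
    proof -
      consider "k < j - 1" | "k = j - 1" | "k > j - 1" by linarith
      then show ?thesis
        using fac[OF k] j(1) k
        by cases (auto simp: As_def nth_append id_V_def F_V_def Kinv_V_def nth_Cons' split: if_splits)
    qed
    have "sum_list s = (\<Sum>k<m. s ! k)"
      using s by (simp add: words_def sum_list_sum_nth atLeast0LessThan)
    also have "\<dots> = (\<Sum>k<m. t ! k) - (\<Sum>k<m. if k = j - 1 then 2 else 0)"
      using rel by (simp add: sum_subtractf)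
    also have "(\<Sum>k<m. if k = j - 1 then 2 else 0 :: int) = 2"
      using j(1) by (subst sum.delta) auto
    also have "(\<Sum>k<m. t ! k) = sum_list t"
      using t(1) by (simp add: words_def sum_list_sum_nth atLeast0LessThan)
    finally show ?thesis using bt s by simp
  qed
  then show ?thesis by (auto simp: has_weight_def tensor_power_def)
qed

lemma has_weight_\<Phi>\<^sub>2:
  assumes "has_weight m i b"
  shows "has_weight (Suc m) (i - 1) (\<Phi>\<^sub>2 v m i b)"
proof -
  have "has_weight (Suc m) (i - 1) (tensor_y b (-1))"
    using has_weight_tensor_y[OF assms, of "-1"] by simp
  moreover have "has_weight (Suc m) (i - 1) (tensor_y (F_tensor v m b) 1)"
    using has_weight_tensor_y[OF has_weight_F_tensor[OF assms], of 1] by simp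
  ultimately show ?thesis
    unfolding has_weight_def tensor_power_def \<Phi>\<^sub>2_def smul_def fun_diff_def
    by (smt (verit) diff_zero mem_Collect_eq mult_zero_right)
qed

lemma has_weight_mu_upto:
  assumes "set \<alpha> \<subseteq> {1, -1}" "k \<le> length \<alpha>"
  shows "has_weight k (sum_list (take k \<alpha>)) (mu_upto v \<alpha> k)"
  using assms(2)
proof (induction k)
  case 0
  then show ?case by (auto simp: has_weight_def tensor_power_def words_def y_def)
next
  case (Suc k)
  have IH: "has_weight k (sum_list (take k \<alpha>)) (mu_upto v \<alpha> k)" using Suc by simp
  have take: "sum_list (take (Suc k) \<alpha>) = sum_list (take k \<alpha>) + \<alpha> ! k"
    using Suc.prems by (simp add: take_Suc_conv_app_nth)
  have "\<alpha> ! k \<in> {1, -1}"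
    using assms(1) Suc.prems nth_mem[of k \<alpha>] by (meson Suc_le_lessD subsetD)
  then consider "\<alpha> ! k = 1" | "\<alpha> ! k = -1" by blast
  then show ?case
  proof cases
    case 1
    then show ?thesis using has_weight_tensor_y[OF IH, of 1] take by (simp add: \<Phi>\<^sub>1_def)
  next
    case 2
    then show ?thesis using has_weight_\<Phi>\<^sub>2[OF IH] take by simp
  qed
qed

end

theory Submission
  imports Defs
begin

text \<open>
  A vector \<open>b\<close> of weight \<open>w\<close> gives four vectors \<open>\<Upsilon> (\<Upsilon>' b)\<close> two tensor positions further to the
  right, where \<open>\<Upsilon>\<close> and \<open>\<Upsilon>'\<close> are \<open>\<Phi>\<^sub>1\<close> or \<open>\<Phi>\<^sub>2\<close>. Let \<open>u = v y\<^sub>-\<^sub>1 \<otimes> y\<^sub>1 - y\<^sub>1 \<otimes> y\<^sub>-\<^sub>1\<close>, which spans the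
  image of \<open>e\<close> on \<open>V \<otimes> V\<close>. Expanding the definitions, and using only \<open>v [i] = [i - 1] + v\<^sup>i\<close>, one
  finds that \<open>e\<close> in the two new positions kills \<open>\<Phi>\<^sub>1 (\<Phi>\<^sub>1 b)\<close> and \<open>\<Phi>\<^sub>2 (\<Phi>\<^sub>2 b)\<close>, and that
  \<open>e (\<Phi>\<^sub>2 (\<Phi>\<^sub>1 b)) = [w + 2] b \<otimes> u\<close>, \<open>e (\<Phi>\<^sub>1 (\<Phi>\<^sub>2 b)) = - [w] b \<otimes> u\<close>, while
  \<open>\<Phi>\<^sub>1 (\<Phi>\<^sub>2 b) - \<Phi>\<^sub>2 (\<Phi>\<^sub>1 b) = [w + 1] b \<otimes> u\<close>. Dividing by \<open>[w + 1]\<close>, which is a factor of \<open>[n]!\<close>,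
  gives the formulas for \<open>w > 0\<close>. If \<open>w = 0\<close>, then \<open>\<Phi>\<^sub>2 (\<Phi>\<^sub>1 b)\<close> is \<open>- b \<otimes> u\<close> up to the term
  \<open>F b \<otimes> y\<^sub>1 \<otimes> y\<^sub>1\<close>. This term vanishes, because \<open>F\<^sup>w\<^sup>+\<^sup>1 b = 0\<close> for \<open>b = \<mu> \<alpha>'\<close>, so \<open>e\<close> acts on
  \<open>\<Phi>\<^sub>2 (\<Phi>\<^sub>1 b)\<close> by \<open>- [2]\<close> (\<open>F_power_mu_eq_0\<close>).

  These formulas concern the last two positions. They persist when further entries are appended
  to the 1-factor because \<open>e\<^sub>i\<close> commutes with \<open>F\<close> (\<open>TL_e_F_tensor\<close>) and hence with \<open>\<Phi>\<^sub>1\<close> and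
  \<open>\<Phi>\<^sub>2\<close>; the parameters of the later steps agree for \<open>\<alpha>\<close> and \<open>\<beta>\<close> since swapping two neighbouring
  entries does not change the partial sums beyond them (\<open>TL_e_mu_append\<close>).
\<close>

section \<open>Quantum integers\<close>

lemma qint_of_nat: "qint v (int k) = (\<Sum>t<k. v powi (int k - 1 - 2 * int t))"
  by (simp add: qint_def)

lemma qint_Suc:
  assumes "v \<noteq> 0"
  shows "qint v (int (Suc k)) = v * qint v (int k) + v powi (- int k)"
proof -
  have "v * v powi (int k - 1 - 2 * int t) = v powi (int k - 2 * int t)" for t
    using power_int_add_1'[OF disjI1[OF assms], of "int k - 1 - 2 * int t"] by simp
  then show ?thesis
    unfolding qint_of_nat by (simp add: sum_distrib_left)
qed

lemma mult_qint_of_nat_Suc: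
  assumes "v \<noteq> 0"
  shows "v * qint v (int (Suc k)) = qint v (int k) + v powi (int (Suc k))"
proof -
  have *: "v * v powi (int (Suc k) - 1 - 2 * int t) = v powi (int (Suc k) - 2 * int t)" for t
    using power_int_add_1'[OF disjI1[OF assms], of "int (Suc k) - 1 - 2 * int t"]
    by (simp add: algebra_simps)
  have "v * qint v (int (Suc k)) = (\<Sum>t<Suc k. v powi (int (Suc k) - 2 * int t))"
    unfolding qint_of_nat sum_distrib_left by (rule sum.cong[OF refl]) (rule *)
  also have "\<dots> = v powi (int (Suc k)) + (\<Sum>t<k. v powi (int k - 1 - 2 * int t))"
    unfolding sum.lessThan_Suc_shift by (simp add: algebra_simps)
  finally show ?thesis by (simp add: qint_of_nat add.commute)
qed

lemma mult_qint:
  assumes "v \<noteq> 0" "1 \<le> i"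
  shows "v * qint v i = qint v (i - 1) + v powi i"
proof -
  have "int (Suc (nat (i - 1))) = i" "int (nat (i - 1)) = i - 1" using assms(2) by simp_all
  then show ?thesis using mult_qint_of_nat_Suc[OF assms(1), of "nat (i - 1)"] by (simp only:)
qed

lemma qint_nonzero_of_qfact:
  assumes "qfact v n \<noteq> 0" "1 \<le> k" "k \<le> int n"
  shows "qint v k \<noteq> 0"
proof -
  have "nat k \<in> {1..n}" using assms(2,3) by auto
  then have "qint v (int (nat k)) \<noteq> 0"
    using assms(1) unfolding qfact_def by (meson finite_atLeastAtMost prod_zero_iff)
  then show ?thesis using assms(2) by simp
qed

section \<open>Linearity, and tensors by their last factor\<close>

text \<open>
  Identities between tensors are proved in two stages: the operators are expanded by linearity, and
  then coordinates are compared. Mixing the two would turn sums inside operators into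
  \<open>\<lambda>\<close>-abstractions, to which linearity no longer applies.
\<close>

declare plus_fun_apply [simp del] minus_apply [simp del] zero_fun_apply [simp del]

lemma finite_words: "finite (words m)"
  using finite_lists_length_eq[of "{1, -1::int}" m] by (simp add: words_def conj_commute)

lemma smul_apply: "(c *\<^sub>v x) s = c * x s"
  by (simp add: smul_def)

lemmas pointwise = fun_eq_iff smul_apply plus_fun_apply minus_apply zero_fun_apply

lemma smul_simps [simp]: "c *\<^sub>v 0 = 0" "0 *\<^sub>v x = 0" "1 *\<^sub>v x = x"
  by (auto simp: pointwise)

lemma tensor_y_linear:
  "tensor_y (x + z) a = tensor_y x a + tensor_y z a"
  "tensor_y (x - z) a = tensor_y x a - tensor_y z a"
  "tensor_y (c *\<^sub>v x) a = c *\<^sub>v tensor_y x a"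
  "tensor_y 0 a = 0"
  by (auto simp: tensor_y_def pointwise)

lemma tensor_op_linear:
  "tensor_op As (x + z) = tensor_op As x + tensor_op As z"
  "tensor_op As (x - z) = tensor_op As x - tensor_op As z"
  "tensor_op As (c *\<^sub>v x) = c *\<^sub>v tensor_op As x"
  "tensor_op As 0 = 0"
  by (auto simp: tensor_op_def pointwise sum.distrib sum_subtractf sum_distrib_left algebra_simps)

lemma smul_sum: "c *\<^sub>v (\<Sum>j\<in>A. f j) = (\<Sum>j\<in>A. c *\<^sub>v f j)"
  by (rule ext) (simp add: smul_apply sum_tensor_apply sum_distrib_left)

lemma F_tensor_linear:
  "F_tensor v m (x + z) = F_tensor v m x + F_tensor v m z"
  "F_tensor v m (x - z) = F_tensor v m x - F_tensor v m z"
  "F_tensor v m (c *\<^sub>v x) = c *\<^sub>v F_tensor v m x"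
  "F_tensor v m 0 = 0"
  by (auto simp: F_tensor_def tensor_op_linear sum.distrib sum_subtractf smul_sum)

lemma TL_e_apply: "TL_e v n i x r = (\<Sum>s\<in>words n. x s * TL_basis v i s r)"
  by (simp add: TL_e_def sum_tensor_apply smul_apply)

lemma TL_e_linear:
  "TL_e v n i (x + z) = TL_e v n i x + TL_e v n i z"
  "TL_e v n i (x - z) = TL_e v n i x - TL_e v n i z"
  "TL_e v n i (c *\<^sub>v x) = c *\<^sub>v TL_e v n i x"
  "TL_e v n i 0 = 0"
  by (simp add: TL_e_apply pointwise sum.distrib sum_subtractf sum_distrib_left
      algebra_simps)+

lemmas tensor_linear = tensor_y_linear F_tensor_linear TL_e_linear

lemma tensor_y_in_tensor_power:
  assumes "x \<in> tensor_power m" "a \<in> {1, -1}"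
  shows "tensor_y x a \<in> tensor_power (Suc m)"
  using assms words_snoc[of _ m] by (fastforce simp: tensor_power_def tensor_y_def)

lemma F_tensor_in_tensor_power: "F_tensor v m x \<in> tensor_power m"
proof -
  have "F_tensor v m x s = 0" if "s \<notin> words m" for s
    unfolding F_tensor_def sum_tensor_apply
    by (rule sum.neutral) (use that in \<open>auto simp: tensor_op_def\<close>)
  then show ?thesis by (simp add: tensor_power_def)
qed

lemma F_power_in_tensor_power:
  "x \<in> tensor_power m \<Longrightarrow> (F_tensor v m ^^ k) x \<in> tensor_power m"
  by (cases k) (auto simp: F_tensor_in_tensor_power)

lemma y_snoc: "y (s @ [a]) = tensor_y (y s) a"
  by (rule ext) (auto simp: y_def tensor_y_def)

lemma tensor_power_snoc_decompose:
  assumes "x \<in> tensor_power (Suc m)"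
  obtains p q where "p \<in> tensor_power m" "q \<in> tensor_power m"
    "x = tensor_y p 1 + tensor_y q (-1)"
proof
  have out: "x (s @ [a]) = 0" if "s \<notin> words m" for s a
    using assms that by (auto simp: tensor_power_def words_def)
  show "(\<lambda>s. x (s @ [1])) \<in> tensor_power m" "(\<lambda>s. x (s @ [-1])) \<in> tensor_power m"
    using out by (auto simp: tensor_power_def)
  show "x = tensor_y (\<lambda>s. x (s @ [1])) 1 + tensor_y (\<lambda>s. x (s @ [-1])) (-1)"
  proof
    fix s
    show "x s = (tensor_y (\<lambda>s. x (s @ [1])) 1 + tensor_y (\<lambda>s. x (s @ [-1])) (-1)) s"
      using assms by (cases s rule: rev_cases) (auto simp: tensor_y_def tensor_power_def words_def pointwise)
  qed
qed

lemma sum_words_tensor_y: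
  assumes "a \<in> {1, -1}"
  shows "(\<Sum>s\<in>words (Suc m). tensor_y x a s * g s) = (\<Sum>s\<in>words m. x s * g (s @ [a]))"
proof -
  have "(\<Sum>s\<in>words (Suc m). tensor_y x a s * g s)
      = (\<Sum>s\<in>(\<lambda>s. s @ [a]) ` words m. tensor_y x a s * g s)"
  proof (rule sum.mono_neutral_right)
    show "(\<lambda>s. s @ [a]) ` words m \<subseteq> words (Suc m)"
      using assms by (auto simp: words_def)
    have "s \<in> (\<lambda>s. s @ [a]) ` words m" if "s \<in> words (Suc m)" "tensor_y x a s \<noteq> 0" for s
      using that by (cases s rule: rev_cases) (auto simp: words_def tensor_y_def split: if_splits)
    then show "\<forall>s\<in>words (Suc m) - (\<lambda>s. s @ [a]) ` words m. tensor_y x a s * g s = 0" by auto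
  qed (rule finite_words)
  also have "\<dots> = (\<Sum>s\<in>words m. x s * g (s @ [a]))"
    by (subst sum.reindex) (auto simp: inj_on_def tensor_y_def)
  finally show ?thesis .
qed

lemma sum_mult_y: "x \<in> tensor_power m \<Longrightarrow> (\<Sum>s\<in>words m. x s * y s r) = x r"
  using finite_words[of m] by (auto simp: y_def tensor_power_def if_distrib cong: if_cong)

lemma sum_mult_tensor_y:
  "(\<Sum>s\<in>words m. x s * tensor_y (f s) a r) = tensor_y (\<lambda>r. \<Sum>s\<in>words m. x s * f s r) a r"
  by (simp add: tensor_y_def)

section \<open>The action of F\<close>

lemma tensor_op_snoc:
  assumes "length As = m" "a \<in> {1, -1}"
  shows "tensor_op (As @ [A]) (tensor_y x a)
    = A 1 a *\<^sub>v tensor_y (tensor_op As x) 1 + A (-1) a *\<^sub>v tensor_y (tensor_op As x) (-1)"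
proof
  fix s
  show "tensor_op (As @ [A]) (tensor_y x a) s
    = (A 1 a *\<^sub>v tensor_y (tensor_op As x) 1 + A (-1) a *\<^sub>v tensor_y (tensor_op As x) (-1)) s"
  proof (cases "s \<in> words (Suc m)")
    case False
    then have "tensor_y (tensor_op As x) c s = 0" if "c \<in> {1, -1}" for c
      using that assms words_snoc[of s m] by (auto simp: tensor_y_def tensor_op_def)
    then show ?thesis using False assms by (simp add: tensor_op_def smul_apply plus_fun_apply)
  next
    case True
    then obtain r c where s: "s = r @ [c]" "r \<in> words m" "c \<in> {1, -1}"
      by (cases s rule: rev_cases) (auto simp: words_def)
    have len: "length r = m" using s(2) by (simp add: words_def)
    have split: "(\<Prod>j<Suc m. ((As @ [A]) ! j) (s ! j) ((t @ [a]) ! j))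
        = (\<Prod>j<m. (As ! j) (r ! j) (t ! j)) * A c a" if "t \<in> words m" for t
    proof -
      have "length t = m" using that by (simp add: words_def)
      then show ?thesis using len assms(1) s(1) by (simp add: nth_append)
    qed
    have "tensor_op (As @ [A]) (tensor_y x a) s
      = (\<Sum>t\<in>words (Suc m). tensor_y x a t * (\<Prod>j<Suc m. ((As @ [A]) ! j) (s ! j) (t ! j)))"
      using True assms(1) by (simp add: tensor_op_def mult.commute)
    also have "\<dots> = (\<Sum>t\<in>words m. x t * ((\<Prod>j<m. (As ! j) (r ! j) (t ! j)) * A c a))"
      unfolding sum_words_tensor_y[OF assms(2)] by (rule sum.cong) (simp_all only: split)
    also have "\<dots> = A c a * tensor_op As x r"
      using s(2) assms(1) by (simp add: tensor_op_def sum_distrib_left mult_ac)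
    finally show ?thesis using s(1,3) by (auto simp: smul_apply plus_fun_apply tensor_y_def)
  qed
qed

lemma tensor_op_replicate_id:
  assumes "x \<in> tensor_power m"
  shows "tensor_op (replicate m id_V) x = x"
  using assms
proof (induction m arbitrary: x)
  case 0
  have "words 0 = {[]}" by (auto simp: words_def)
  then show ?case using 0 by (auto simp: tensor_op_def tensor_power_def)
next
  case (Suc m)
  obtain p q where pq: "p \<in> tensor_power m" "q \<in> tensor_power m"
    "x = tensor_y p 1 + tensor_y q (-1)"
    using Suc.prems by (rule tensor_power_snoc_decompose)
  have "replicate (Suc m) id_V = replicate m (id_V :: int \<Rightarrow> int \<Rightarrow> 'a) @ [id_V]"
    by (simp add: replicate_append_same)
  moreover have "id_V 1 1 = (1 :: 'a)" "id_V (-1) (-1) = (1 :: 'a)"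
    "id_V 1 (-1) = (0 :: 'a)" "id_V (-1) 1 = (0 :: 'a)"
    by (simp_all add: id_V_def)
  ultimately show ?case
    using pq Suc.IH by (simp add: tensor_op_linear tensor_op_snoc del: replicate.simps)
qed

text \<open>
  The summands of \<open>F\<close> in which \<open>F\<close> acts on one of the first \<open>m\<close> factors have \<open>K\<^sup>-\<^sup>1\<close> in the last
  position; in the remaining summand all other factors are fixed.
\<close>

lemma F_tensor_tensor_y:
  assumes "x \<in> tensor_power m" "a \<in> {1, -1}"
  shows "F_tensor v (Suc m) (tensor_y x a)
    = v powi (- a) *\<^sub>v tensor_y (F_tensor v m x) a + (if a = 1 then tensor_y x (-1) else 0)"
proof -
  define As where "As j = replicate (j - 1) id_V @ [F_V] @ replicate (m - j) (Kinv_V v)" for j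
  have "tensor_op (replicate (j - 1) id_V @ [F_V] @ replicate (Suc m - j) (Kinv_V v)) (tensor_y x a)
      = v powi (- a) *\<^sub>v tensor_y (tensor_op (As j) x) a" if "j \<in> {1..m}" for j
  proof -
    have "replicate (Suc m - j) (Kinv_V v) = replicate (m - j) (Kinv_V v) @ [Kinv_V v]"
      using that by (simp add: Suc_diff_le replicate_append_same)
    then have "tensor_op (replicate (j - 1) id_V @ [F_V] @ replicate (Suc m - j) (Kinv_V v))
        (tensor_y x a) = tensor_op (As j @ [Kinv_V v]) (tensor_y x a)"
      by (simp add: As_def)
    also have "\<dots> = v powi (- a) *\<^sub>v tensor_y (tensor_op (As j) x) a"
      using that assms(2) by (subst tensor_op_snoc[of _ m]) (auto simp: As_def Kinv_V_def)
    finally show ?thesis .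
  qed
  moreover have "(\<Sum>j=1..m. v powi (- a) *\<^sub>v tensor_y (tensor_op (As j) x) a)
      = v powi (- a) *\<^sub>v tensor_y (F_tensor v m x) a"
    by (rule ext)
      (simp add: F_tensor_def As_def sum_tensor_apply smul_apply tensor_y_def sum_distrib_left)
  moreover have "tensor_op (replicate m id_V @ [F_V]) (tensor_y x a)
      = (if a = 1 then tensor_y x (-1) else 0)"
    using assms by (subst tensor_op_snoc[of _ m]) (auto simp: F_V_def tensor_op_replicate_id)
  ultimately show ?thesis
    by (simp add: F_tensor_def)
qed

lemma F_tensor_plus:
  assumes "x \<in> tensor_power m"
  shows "F_tensor v (Suc m) (tensor_y x 1)
    = inverse v *\<^sub>v tensor_y (F_tensor v m x) 1 + tensor_y x (-1)"
  using F_tensor_tensor_y[OF assms, of 1] by (simp add: power_int_minus)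

lemma F_tensor_minus:
  assumes "x \<in> tensor_power m"
  shows "F_tensor v (Suc m) (tensor_y x (-1)) = v *\<^sub>v tensor_y (F_tensor v m x) (-1)"
  using F_tensor_tensor_y[OF assms, of "-1"] by simp

lemma F_power_plus:
  assumes "v \<noteq> 0" "x \<in> tensor_power m"
  shows "(F_tensor v (Suc m) ^^ Suc k) (tensor_y x 1)
    = v powi (- int (Suc k)) *\<^sub>v tensor_y ((F_tensor v m ^^ Suc k) x) 1
      + qint v (int (Suc k)) *\<^sub>v tensor_y ((F_tensor v m ^^ k) x) (-1)"
proof (induction k)
  case 0
  then show ?case
    using F_tensor_plus[OF assms(2)] by (simp add: qint_def power_int_minus)
next
  case (Suc k)
  have "(F_tensor v (Suc m) ^^ Suc (Suc k)) (tensor_y x 1)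
      = F_tensor v (Suc m) (v powi (- int (Suc k)) *\<^sub>v tensor_y ((F_tensor v m ^^ Suc k) x) 1
      + qint v (int (Suc k)) *\<^sub>v tensor_y ((F_tensor v m ^^ k) x) (-1))"
    using Suc by simp
  also have "\<dots> = (v powi (- int (Suc k)) * inverse v)
        *\<^sub>v tensor_y ((F_tensor v m ^^ Suc (Suc k)) x) 1
      + (v powi (- int (Suc k)) + v * qint v (int (Suc k)))
        *\<^sub>v tensor_y ((F_tensor v m ^^ Suc k) x) (-1)"
    unfolding F_tensor_linear F_tensor_plus[OF F_power_in_tensor_power[OF assms(2)]]
      F_tensor_minus[OF F_power_in_tensor_power[OF assms(2)]]
    by (simp add: pointwise algebra_simps)
  also have "v powi (- int (Suc k)) * inverse v = v powi (- int (Suc (Suc k)))"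
    using power_int_diff[of v "- int (Suc k)" 1] assms(1) by (simp add: divide_inverse)
  also have "v powi (- int (Suc k)) + v * qint v (int (Suc k)) = qint v (int (Suc (Suc k)))"
    using qint_Suc[OF assms(1), of "Suc k"] by simp
  finally show ?case .
qed

lemma F_power_minus:
  assumes "x \<in> tensor_power m"
  shows "(F_tensor v (Suc m) ^^ k) (tensor_y x (-1))
    = v ^ k *\<^sub>v tensor_y ((F_tensor v m ^^ k) x) (-1)"
proof (induction k)
  case (Suc k)
  then show ?case
    by (simp add: F_tensor_linear F_tensor_minus[OF F_power_in_tensor_power[OF assms]])
      (simp add: pointwise)
qed simp

lemma F_power_linear:
  "(F_tensor v m ^^ k) (x - z) = (F_tensor v m ^^ k) x - (F_tensor v m ^^ k) z"
  "(F_tensor v m ^^ k) (c *\<^sub>v x) = c *\<^sub>v (F_tensor v m ^^ k) x"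
  by (induction k) (simp_all add: F_tensor_linear)

section \<open>The Temperley-Lieb operators\<close>

lemma TL_e_tensor_y:
  assumes "1 \<le> i" "i < m" "a \<in> {1, -1}"
  shows "TL_e v (Suc m) i (tensor_y x a) = tensor_y (TL_e v m i x) a"
proof
  fix r
  have basis: "TL_basis v i (s @ [a]) = tensor_y (TL_basis v i s) a" if "s \<in> words m" for s
    using that assms
    by (auto simp: TL_basis_def words_def nth_append list_update_append y_snoc tensor_linear)
  have "TL_e v (Suc m) i (tensor_y x a) r = (\<Sum>s\<in>words m. x s * tensor_y (TL_basis v i s) a r)"
    unfolding TL_e_apply sum_words_tensor_y[OF assms(3)]
    by (rule sum.cong) (simp_all add: basis)
  also have "\<dots> = tensor_y (TL_e v m i x) a r"
    unfolding sum_mult_tensor_y by (simp add: tensor_y_def TL_e_apply)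
  finally show "TL_e v (Suc m) i (tensor_y x a) r = tensor_y (TL_e v m i x) a r" .
qed

lemma TL_e_last_two:
  assumes "x \<in> tensor_power m" "a \<in> {1, -1}" "b \<in> {1, -1}"
  shows "TL_e v (Suc (Suc m)) (Suc m) (tensor_y (tensor_y x a) b)
    = (if a = 1 \<and> b = -1 then
         tensor_y (tensor_y x (-1)) 1 - inverse v *\<^sub>v tensor_y (tensor_y x 1) (-1)
       else if a = -1 \<and> b = 1 then
         tensor_y (tensor_y x 1) (-1) - v *\<^sub>v tensor_y (tensor_y x (-1)) 1
       else 0)" (is "?l = ?r")
proof
  fix r
  have expand: "(\<Sum>s\<in>words m. x s * tensor_y (tensor_y (y s) c) d r)
      = tensor_y (tensor_y x c) d r" for c d
    by (simp add: tensor_y_def sum_mult_y[OF assms(1)])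
  have y2: "y (s @ [c, d]) = (tensor_y (tensor_y (y s) c) d :: 'a tensor)" for s c d
    using y_snoc[of "s @ [c]" d] by (simp add: y_snoc)
  have basis: "TL_basis v (Suc m) ((s @ [a]) @ [b]) r
    = (if a = 1 \<and> b = -1 then
         tensor_y (tensor_y (y s) (-1)) 1 r - inverse v * tensor_y (tensor_y (y s) 1) (-1) r
       else if a = -1 \<and> b = 1 then
         tensor_y (tensor_y (y s) 1) (-1) r - v * tensor_y (tensor_y (y s) (-1)) 1 r
       else 0)" if "s \<in> words m" for s
    using that by (auto simp: TL_basis_def words_def nth_append list_update_append y2 pointwise)
  have "?l r = (\<Sum>s\<in>words m. x s * TL_basis v (Suc m) ((s @ [a]) @ [b]) r)"
    unfolding TL_e_apply sum_words_tensor_y[OF assms(3)] sum_words_tensor_y[OF assms(2)] ..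
  also have "\<dots> = (\<Sum>s\<in>words m. x s * (if a = 1 \<and> b = -1 then
         tensor_y (tensor_y (y s) (-1)) 1 r - inverse v * tensor_y (tensor_y (y s) 1) (-1) r
       else if a = -1 \<and> b = 1 then
         tensor_y (tensor_y (y s) 1) (-1) r - v * tensor_y (tensor_y (y s) (-1)) 1 r
       else 0))"
    by (rule sum.cong) (simp_all only: basis)
  also have "\<dots> = ?r r"
    using assms(2,3)
    by (elim insertE; simp add: right_diff_distrib sum_subtractf mult.left_commute[of _ v]
        mult.left_commute[of _ "inverse v"] sum_distrib_left[symmetric] expand pointwise)
  finally show "?l r = ?r r" .
qed

lemmas TL_e_plus_minus = TL_e_last_two[where a = 1 and b = "-1", simplified]
  and TL_e_minus_plus = TL_e_last_two[where a = "-1" and b = 1, simplified]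
  and TL_e_plus_plus = TL_e_last_two[where a = 1 and b = 1, simplified]
  and TL_e_minus_minus = TL_e_last_two[where a = "-1" and b = "-1", simplified]

lemmas TL_e_letters = TL_e_plus_minus TL_e_minus_plus TL_e_plus_plus TL_e_minus_minus

lemma TL_e_in_tensor_power:
  assumes "1 \<le> i" "i < n"
  shows "TL_e v n i x \<in> tensor_power n"
proof -
  have "TL_basis v i s r = 0" if "s \<in> words n" "r \<notin> words n" for r s
  proof -
    have "s[i - 1 := c, i := d] \<in> words n" if "c \<in> {1, -1}" "d \<in> {1, -1}" for c d
      using \<open>s \<in> words n\<close> that set_update_subset_insert[of s "i - 1" c]
        set_update_subset_insert[of "s[i - 1 := c]" i d] by (auto simp: words_def)
    then show ?thesis using that by (auto simp: TL_basis_def y_def pointwise)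
  qed
  then show ?thesis by (simp add: tensor_power_def TL_e_apply)
qed

text \<open>
  Both operators are compatible with splitting off the last tensor factor, so everything reduces
  to \<open>e\<close> acting in the last two positions. There \<open>e\<close> preserves weights
  and so commutes with \<open>K\<^sup>-\<^sup>1\<close>, and both products of \<open>e\<close> and \<open>F\<close> vanish on \<open>V \<otimes> V\<close>, since \<open>F\<close>
  kills the image of \<open>e\<close> and has its image in the kernel of \<open>e\<close>.
\<close>

lemma TL_e_F_tensor:
  assumes "v \<noteq> 0" "1 \<le> i" "i < n" "x \<in> tensor_power n"
  shows "TL_e v n i (F_tensor v n x) = F_tensor v n (TL_e v n i x)"
proof -
  have "Suc i \<le> n" using assms(3) by simp
  then show ?thesis using assms(4)
  proof (induction n arbitrary: x rule: dec_induct)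
    case base
    obtain m where i: "i = Suc m" using assms(2) by (cases i) auto
    have x: "x \<in> tensor_power (Suc (Suc m))" using base i by simp
    obtain p q where pq: "p \<in> tensor_power (Suc m)" "q \<in> tensor_power (Suc m)"
      "x = tensor_y p 1 + tensor_y q (-1)"
      using x by (rule tensor_power_snoc_decompose)
    obtain a b where ab: "a \<in> tensor_power m" "b \<in> tensor_power m"
      "p = tensor_y a 1 + tensor_y b (-1)"
      using pq(1) by (rule tensor_power_snoc_decompose)
    obtain c d where cd: "c \<in> tensor_power m" "d \<in> tensor_power m"
      "q = tensor_y c 1 + tensor_y d (-1)"
      using pq(2) by (rule tensor_power_snoc_decompose)
    have commute: "TL_e v (Suc (Suc m)) (Suc m) (F_tensor v (Suc (Suc m)) (tensor_y (tensor_y z k) l))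
        = F_tensor v (Suc (Suc m)) (TL_e v (Suc (Suc m)) (Suc m) (tensor_y (tensor_y z k) l))"
      if z: "z \<in> tensor_power m" and kl: "k \<in> {1, -1}" "l \<in> {1, -1}" for z k l
    proof -
      have zp: "tensor_y z 1 \<in> tensor_power (Suc m)" "tensor_y z (-1) \<in> tensor_power (Suc m)"
        using z by (auto intro: tensor_y_in_tensor_power)
      show ?thesis
        using kl assms(1) z
        by (elim insertE; simp add: tensor_linear F_tensor_plus F_tensor_minus TL_e_letters zp
            F_tensor_in_tensor_power; simp add: pointwise algebra_simps)
    qed
    show ?case
      using ab cd by (simp add: i pq(3) tensor_linear commute)
  next
    case (step n)
    obtain p q where pq: "p \<in> tensor_power n" "q \<in> tensor_power n"
      "x = tensor_y p 1 + tensor_y q (-1)"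
      using step.prems by (rule tensor_power_snoc_decompose)
    have "i < n" using step.hyps by simp
    then show ?case
      using pq assms(2)
      by (simp add: tensor_linear F_tensor_plus F_tensor_minus TL_e_tensor_y TL_e_in_tensor_power
          step.IH)
  qed
qed

section \<open>The vectors of 1-factors\<close>

lemma mu_upto_cong: "take k \<alpha> = take k \<beta> \<Longrightarrow> k \<le> length \<alpha> \<Longrightarrow> k \<le> length \<beta>
    \<Longrightarrow> mu_upto v \<alpha> k = mu_upto v \<beta> k"
proof (induction k)
  case (Suc k)
  have "\<alpha> ! k = \<beta> ! k" using Suc.prems(1) by (metis lessI nth_take)
  moreover have "take k \<alpha> = take k \<beta>"
    using Suc.prems(1) by (metis min.absorb1 le_SucI order_refl take_take)
  ultimately show ?case using Suc by simp
qed simp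

lemma mu_snoc:
  "mu v (xs @ [1]) = \<Phi>\<^sub>1 (mu v xs)"
  "mu v (xs @ [-1]) = \<Phi>\<^sub>2 v (length xs) (sum_list xs) (mu v xs)"
proof -
  have "mu_upto v (xs @ [a]) (length xs) = mu_upto v xs (length xs)" for a
    by (rule mu_upto_cong) auto
  then show "mu v (xs @ [1]) = \<Phi>\<^sub>1 (mu v xs)"
    "mu v (xs @ [-1]) = \<Phi>\<^sub>2 v (length xs) (sum_list xs) (mu v xs)"
    by (simp_all add: mu_def)
qed

lemma mu_in_tensor_power:
  "set xs \<subseteq> {1, -1} \<Longrightarrow> mu v xs \<in> tensor_power (length xs)"
  using has_weight_mu_upto[of xs "length xs" v] by (simp add: mu_def has_weight_def)

lemma one_factor_appendD:
  assumes "one_factor (xs @ ys)"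
  shows "one_factor xs"
proof -
  have "0 \<le> sum_list (take i xs)" if "i \<le> length xs" for i
  proof -
    have "0 \<le> sum_list (take i (xs @ ys))"
      using assms that unfolding one_factor_def by (metis le_add1 length_append order_trans)
    then show ?thesis using that by simp
  qed
  then show ?thesis using assms by (simp add: one_factor_def)
qed

lemma one_factor_sum_nonneg: "one_factor xs \<Longrightarrow> 0 \<le> sum_list xs"
  unfolding one_factor_def by (metis order_refl take_all_iff)

text \<open>
  A highest weight vector of weight \<open>w\<close> generates a module of dimension at most \<open>w + 1\<close>; here the
  bound on the nilpotency is obtained directly from \<open>\<Phi>\<^sub>1\<close> and \<open>\<Phi>\<^sub>2\<close>. For \<open>\<Phi>\<^sub>2 b\<close>, where \<open>b\<close> has
  weight \<open>i\<close>, each of the two terms of \<open>F\<^sup>i (\<Phi>\<^sub>2 b)\<close> contributes \<open>v\<^sup>i [i] F\<^sup>i b \<otimes> y\<^sub>-\<^sub>1\<close>, with opposite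
  signs, and what remains is \<open>F\<^sup>i\<^sup>+\<^sup>1 b \<otimes> y\<^sub>1\<close> up to sign, which is 0 by induction.
\<close>

lemma F_power_mu_eq_0:
  assumes "v \<noteq> 0" "one_factor xs"
  shows "(F_tensor v (length xs) ^^ Suc (nat (sum_list xs))) (mu v xs) = 0"
  using assms(2)
proof (induction xs rule: rev_induct)
  case Nil
  then show ?case by (simp add: F_tensor_def)
next
  case (snoc a xs)
  have xs: "one_factor xs" and a: "a \<in> {1, -1}"
    using snoc.prems one_factor_appendD[of xs "[a]"] by (auto simp: one_factor_def)
  define b where "b = mu v xs"
  define m where "m = length xs"
  define k where "k = nat (sum_list xs)"
  have b: "b \<in> tensor_power m"
    unfolding b_def m_def using xs by (intro mu_in_tensor_power) (simp add: one_factor_def)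
  have sum: "sum_list xs = int k"
    using one_factor_sum_nonneg[OF xs] by (simp add: k_def)
  have IH: "(F_tensor v m ^^ Suc k) b = 0"
    using snoc.IH[OF xs] by (simp add: b_def m_def k_def)
  then have IH': "(F_tensor v m ^^ Suc (Suc k)) b = 0"
    by (simp add: F_tensor_linear)
  show ?case
  proof (cases "a = 1")
    case True
    have "(F_tensor v (Suc m) ^^ Suc (Suc k)) (tensor_y b 1) = 0"
      unfolding F_power_plus[OF assms(1) b] IH IH' by (simp add: tensor_linear)
    moreover have "nat (sum_list (xs @ [a])) = Suc k" using True sum by simp
    ultimately show ?thesis
      by (simp only: True mu_snoc \<Phi>\<^sub>1_def b_def m_def length_append_singleton)
  next
    case False
    then have a: "a = -1" using a by simp
    then have "0 \<le> int k - 1"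
      using one_factor_sum_nonneg[OF snoc.prems] sum by simp
    then obtain j where k: "k = Suc j" by (cases k) auto
    have "nat (sum_list (xs @ [a])) = j" using a k sum by simp
    moreover have "(F_tensor v (Suc m) ^^ k) (\<Phi>\<^sub>2 v m (int k) b) = 0"
    proof -
      have "(F_tensor v (Suc m) ^^ k) (tensor_y (F_tensor v m b) 1)
          = qint v (int k) *\<^sub>v tensor_y ((F_tensor v m ^^ k) b) (-1)"
        using F_power_plus[OF assms(1) F_tensor_in_tensor_power[of v m b], of j] IH k
        by (simp add: funpow_Suc_right tensor_linear del: funpow.simps)
      then show ?thesis
        unfolding \<Phi>\<^sub>2_def F_power_linear F_power_minus[OF b]
        by (simp add: tensor_linear) (simp add: pointwise)
    qed
    ultimately show ?thesis
      using k a sum by (simp only: mu_snoc b_def m_def length_append_singleton)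
  qed
qed

section \<open>The action on the last two entries\<close>

context
  fixes v :: "'k::field" and m :: nat and b :: "'k tensor" and i :: int
  assumes v: "v \<noteq> 0" and b: "b \<in> tensor_power m" and i: "0 \<le> i"
begin

lemma \<Phi>\<^sub>2_\<Phi>\<^sub>1_expand:
  "\<Phi>\<^sub>2 v (Suc m) (i + 1) (\<Phi>\<^sub>1 b) = qint v (i + 1) *\<^sub>v tensor_y (tensor_y b 1) (-1)
     - v powi (i + 1) *\<^sub>v tensor_y (tensor_y b (-1)) 1
     - v powi i *\<^sub>v tensor_y (tensor_y (F_tensor v m b) 1) 1"
  using v by (simp add: \<Phi>\<^sub>2_def \<Phi>\<^sub>1_def F_tensor_plus[OF b] tensor_linear)
    (simp add: pointwise power_int_add algebra_simps)

lemma \<Phi>\<^sub>1_\<Phi>\<^sub>2_expand: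
  "\<Phi>\<^sub>1 (\<Phi>\<^sub>2 v m i b) = qint v i *\<^sub>v tensor_y (tensor_y b (-1)) 1
     - v powi i *\<^sub>v tensor_y (tensor_y (F_tensor v m b) 1) 1"
  by (simp add: \<Phi>\<^sub>2_def \<Phi>\<^sub>1_def tensor_linear)

lemma \<Phi>\<^sub>2_\<Phi>\<^sub>2_expand:
  assumes "1 \<le> i"
  shows "\<Phi>\<^sub>2 v (Suc m) (i - 1) (\<Phi>\<^sub>2 v m i b)
    = (qint v (i - 1) * qint v i) *\<^sub>v tensor_y (tensor_y b (-1)) (-1)
      - (v powi i * qint v (i - 1)) *\<^sub>v tensor_y (tensor_y (F_tensor v m b) 1) (-1)
      - (v powi (i - 1) * qint v (i - 1)) *\<^sub>v tensor_y (tensor_y (F_tensor v m b) (-1)) 1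
      + (v powi (i - 1) * v powi (i - 1))
          *\<^sub>v tensor_y (tensor_y (F_tensor v m (F_tensor v m b)) 1) 1"
proof -
  have pow: "v powi i = v * v powi (i - 1)"
    using v by (simp add: power_int_diff)
  have F: "F_tensor v (Suc m) (\<Phi>\<^sub>2 v m i b)
      = qint v (i - 1) *\<^sub>v tensor_y (F_tensor v m b) (-1)
        - v powi (i - 1) *\<^sub>v tensor_y (F_tensor v m (F_tensor v m b)) 1"
  proof -
    have q: "qint v (i - 1) = v * qint v i - v powi i"
      using mult_qint[OF v assms] by simp
    show ?thesis
      using v unfolding q
      by (simp add: \<Phi>\<^sub>2_def tensor_linear F_tensor_plus F_tensor_minus b F_tensor_in_tensor_power)
        (simp add: pointwise pow algebra_simps)
  qed
  show ?thesis
    unfolding \<Phi>\<^sub>2_def[of v "Suc m"] F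
    by (simp add: \<Phi>\<^sub>2_def tensor_linear) (simp add: pointwise algebra_simps)
qed

lemma TL_e_\<Phi>\<^sub>2_\<Phi>\<^sub>1:
  "TL_e v (Suc (Suc m)) (Suc m) (\<Phi>\<^sub>2 v (Suc m) (i + 1) (\<Phi>\<^sub>1 b))
    = qint v (i + 2) *\<^sub>v (v *\<^sub>v tensor_y (tensor_y b (-1)) 1 - tensor_y (tensor_y b 1) (-1))"
proof -
  have q: "qint v (i + 1) = v * qint v (i + 2) - v * v powi (i + 1)"
    using mult_qint[OF v, of "i + 2"] i v power_int_add_1'[of v "i + 1"] by (simp add: add.commute)
  have cancel: "v * (inverse v * z) = z" for z using v by simp
  show ?thesis
    unfolding \<Phi>\<^sub>2_\<Phi>\<^sub>1_expand q
    by (simp add: tensor_linear TL_e_letters b F_tensor_in_tensor_power)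
      (simp add: pointwise algebra_simps cancel)
qed

lemma TL_e_\<Phi>\<^sub>1_\<Phi>\<^sub>2:
  "TL_e v (Suc (Suc m)) (Suc m) (\<Phi>\<^sub>1 (\<Phi>\<^sub>2 v m i b))
    = (- qint v i) *\<^sub>v (v *\<^sub>v tensor_y (tensor_y b (-1)) 1 - tensor_y (tensor_y b 1) (-1))"
  by (simp add: \<Phi>\<^sub>1_\<Phi>\<^sub>2_expand tensor_linear TL_e_letters b F_tensor_in_tensor_power)
    (simp add: pointwise algebra_simps)

lemma \<Phi>\<^sub>1_\<Phi>\<^sub>2_minus_\<Phi>\<^sub>2_\<Phi>\<^sub>1:
  "\<Phi>\<^sub>1 (\<Phi>\<^sub>2 v m i b) - \<Phi>\<^sub>2 v (Suc m) (i + 1) (\<Phi>\<^sub>1 b)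
    = qint v (i + 1) *\<^sub>v (v *\<^sub>v tensor_y (tensor_y b (-1)) 1 - tensor_y (tensor_y b 1) (-1))"
proof -
  have q: "qint v i = v * qint v (i + 1) - v powi (i + 1)"
    using mult_qint[OF v, of "i + 1"] i by simp
  show ?thesis
    unfolding \<Phi>\<^sub>2_\<Phi>\<^sub>1_expand \<Phi>\<^sub>1_\<Phi>\<^sub>2_expand q
    by (auto simp: pointwise algebra_simps)
qed

lemma TL_e_\<Phi>\<^sub>1_\<Phi>\<^sub>1: "TL_e v (Suc (Suc m)) (Suc m) (\<Phi>\<^sub>1 (\<Phi>\<^sub>1 b)) = 0"
  by (simp add: \<Phi>\<^sub>1_def TL_e_letters b)

text \<open>
  Only the two terms containing \<open>F b\<close> once survive \<open>e\<close>, and they cancel because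
  \<open>e (y\<^sub>-\<^sub>1 \<otimes> y\<^sub>1) = - v e (y\<^sub>1 \<otimes> y\<^sub>-\<^sub>1)\<close>, which matches the quotient \<open>v\<close> of their coefficients.
\<close>

lemma TL_e_\<Phi>\<^sub>2_\<Phi>\<^sub>2:
  assumes "1 \<le> i"
  shows "TL_e v (Suc (Suc m)) (Suc m) (\<Phi>\<^sub>2 v (Suc m) (i - 1) (\<Phi>\<^sub>2 v m i b)) = 0"
proof -
  have pow: "v powi i = v * v powi (i - 1)"
    using v by (simp add: power_int_diff)
  show ?thesis
    using v unfolding \<Phi>\<^sub>2_\<Phi>\<^sub>2_expand[OF assms] pow
    by (simp add: tensor_linear TL_e_letters b F_tensor_in_tensor_power)
      (simp add: pointwise algebra_simps)
qed

end

section \<open>Appending further entries\<close>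

text \<open>
  Applying \<open>\<Phi>\<^sub>1\<close> or \<open>\<Phi>\<^sub>2\<close> preserves a linear relation between \<open>e\<^sub>i (\<mu> p)\<close>, \<open>\<mu> q\<close> and \<open>\<mu> p\<close>. The
  conditions on lengths and sums make the same instance of \<open>\<Phi>\<^sub>2\<close> occur on both sides. The form with
  two coefficients serves all cases of the proposition at once.
\<close>

lemma TL_e_mu_append:
  assumes "v \<noteq> 0" "1 \<le> i" "i < length p" "length q = length p" "sum_list q = sum_list p"
    and "set p \<subseteq> {1, -1}"
    and "TL_e v (length p) i (mu v p) = c *\<^sub>v mu v q + d *\<^sub>v mu v p"
    and "set t \<subseteq> {1, -1}"
  shows "TL_e v (length (p @ t)) i (mu v (p @ t)) = c *\<^sub>v mu v (q @ t) + d *\<^sub>v mu v (p @ t)"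
  using assms(8)
proof (induction t rule: rev_induct)
  case Nil
  then show ?case using assms(7) by simp
next
  case (snoc a t)
  define x where "x = mu v (p @ t)"
  define z where "z = mu v (q @ t)"
  define m where "m = length (p @ t)"
  define w where "w = sum_list (p @ t)"
  have IH: "TL_e v m i x = c *\<^sub>v z + d *\<^sub>v x"
    using snoc by (simp add: x_def z_def m_def)
  have x: "x \<in> tensor_power m"
    unfolding x_def m_def by (rule mu_in_tensor_power) (use assms(6) snoc.prems in auto)
  have im: "i < m" using assms(3) by (simp add: m_def)
  have params: "length (q @ t) = m" "sum_list (q @ t) = w"
    using assms(4,5) by (simp_all add: m_def w_def)
  consider "a = 1" | "a = -1" using snoc.prems by auto
  then show ?case
  proof cases
    case 1
    have "TL_e v (Suc m) i (\<Phi>\<^sub>1 x) = c *\<^sub>v \<Phi>\<^sub>1 z + d *\<^sub>v \<Phi>\<^sub>1 x"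
      by (simp add: \<Phi>\<^sub>1_def TL_e_tensor_y[OF assms(2) im] IH tensor_linear)
    then show ?thesis
      using mu_snoc(1)[of v "p @ t"] mu_snoc(1)[of v "q @ t"]
      by (simp add: 1 x_def z_def m_def)
  next
    case 2
    have "TL_e v (Suc m) i (\<Phi>\<^sub>2 v m w x) = c *\<^sub>v \<Phi>\<^sub>2 v m w z + d *\<^sub>v \<Phi>\<^sub>2 v m w x"
      by (simp add: \<Phi>\<^sub>2_def TL_e_tensor_y[OF assms(2) im] IH tensor_linear
          TL_e_F_tensor[OF assms(1,2) im x]) (simp add: pointwise algebra_simps)
    then show ?thesis
      using mu_snoc(2)[of v "p @ t"] mu_snoc(2)[of v "q @ t"]
      unfolding params by (simp add: 2 x_def z_def m_def w_def)
  qed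
qed

theorem proposition7p1:
  fixes v :: "'k::field"
    and n i :: nat
    and \<alpha> \<alpha>' \<alpha>'' \<beta> :: "int list"
    and a b w :: int
  assumes "v \<noteq> 0"
    and "qfact v n \<noteq> 0"
    and "one_factor \<alpha>" and "length \<alpha> = n"
    and "1 \<le> i" and "i \<le> n - 1"
    and "\<alpha> = \<alpha>' @ [a, b] @ \<alpha>''" and "length \<alpha>' = i - 1"
    and "w = sum_list \<alpha>'"
    and "a * b = -1 \<longrightarrow> \<beta> = \<alpha>' @ [- a, - b] @ \<alpha>''"
  shows "(w = 0 \<and> a * b = -1 \<longrightarrow>
            TL_e v n i (mu v \<alpha>) = (- (v + inverse v)) *\<^sub>v mu v \<alpha>)
       \<and> (w > 0 \<longrightarrow>
            TL_e v n i (mu v \<alpha>) =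
              (if (a, b) = (1, -1) then (qint v (w + 2) / qint v (w + 1)) *\<^sub>v (mu v \<beta> - mu v \<alpha>)
               else if (a, b) = (-1, 1) then (qint v w / qint v (w + 1)) *\<^sub>v (mu v \<beta> - mu v \<alpha>)
               else 0))"
proof -
  define x where "x = mu v \<alpha>'"
  define m where "m = length \<alpha>'"
  have sets: "set \<alpha>' \<subseteq> {1, -1}" "set \<alpha>'' \<subseteq> {1, -1}" "a \<in> {1, -1}" "b \<in> {1, -1}"
    using assms(3) by (auto simp: one_factor_def assms(7))
  have x: "x \<in> tensor_power m"
    unfolding x_def m_def using sets(1) by (rule mu_in_tensor_power)
  have i: "i = Suc m" using assms(5,8) by (simp add: m_def)
  have n: "n = Suc (Suc (m + length \<alpha>''))" using assms(4,7) by (simp add: m_def)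
  have one: "one_factor \<alpha>'" "one_factor (\<alpha>' @ [a])"
    using assms(3) one_factor_appendD[of \<alpha>' "[a, b] @ \<alpha>''"]
      one_factor_appendD[of "\<alpha>' @ [a]" "[b] @ \<alpha>''"] by (simp_all add: assms(7))
  have w0: "0 \<le> w" "0 \<le> w + a"
    using one_factor_sum_nonneg[OF one(1)] one_factor_sum_nonneg[OF one(2)]
    by (simp_all add: assms(9))
  \<comment> \<open>Every partial sum is at most the length of its prefix, so \<open>w + 1 \<le> n\<close> and \<open>[w + 1] \<noteq> 0\<close>.\<close>
  have "sum_list xs \<le> int (length xs)" if "set xs \<subseteq> {1, -1}" for xs :: "int list"
    using that by (induction xs) auto
  then have "w \<le> int m" using sets(1) by (simp add: assms(9) m_def)
  then have q: "qint v (w + 1) \<noteq> 0"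
    using w0(1) n by (intro qint_nonzero_of_qfact[OF assms(2)]) auto
  have mu2: "mu v (\<alpha>' @ [1, 1]) = \<Phi>\<^sub>1 (\<Phi>\<^sub>1 x)"
    "mu v (\<alpha>' @ [1, -1]) = \<Phi>\<^sub>2 v (Suc m) (w + 1) (\<Phi>\<^sub>1 x)"
    "mu v (\<alpha>' @ [-1, 1]) = \<Phi>\<^sub>1 (\<Phi>\<^sub>2 v m w x)"
    "mu v (\<alpha>' @ [-1, -1]) = \<Phi>\<^sub>2 v (Suc m) (w - 1) (\<Phi>\<^sub>2 v m w x)"
    using mu_snoc[of v \<alpha>'] mu_snoc[of v "\<alpha>' @ [1]"] mu_snoc[of v "\<alpha>' @ [-1]"]
    by (simp_all add: x_def m_def assms(9))
  have extend: "TL_e v n i (mu v \<alpha>) = c *\<^sub>v mu v (\<alpha>' @ [r, s] @ \<alpha>'') + d *\<^sub>v mu v \<alpha>"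
    if "TL_e v (Suc (Suc m)) (Suc m) (mu v (\<alpha>' @ [a, b]))
        = c *\<^sub>v mu v (\<alpha>' @ [r, s]) + d *\<^sub>v mu v (\<alpha>' @ [a, b])"
      and "r + s = a + b" for c d r s
    using TL_e_mu_append[of v i "\<alpha>' @ [a, b]" "\<alpha>' @ [r, s]" c d \<alpha>''] that assms(1) sets i
    by (simp add: m_def n assms(7))
  \<comment> \<open>This is \<open>x \<otimes> u\<close> for the vector \<open>u\<close> that spans the image of \<open>e\<close> on \<open>V \<otimes> V\<close>.\<close>
  define xu where "xu = v *\<^sub>v tensor_y (tensor_y x (-1)) 1 - tensor_y (tensor_y x 1) (-1)"
  note e21 = TL_e_\<Phi>\<^sub>2_\<Phi>\<^sub>1[OF assms(1) x w0(1), folded xu_def]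
  note e12 = TL_e_\<Phi>\<^sub>1_\<Phi>\<^sub>2[OF assms(1) x w0(1), folded xu_def]
  note diff = \<Phi>\<^sub>1_\<Phi>\<^sub>2_minus_\<Phi>\<^sub>2_\<Phi>\<^sub>1[OF assms(1) x w0(1), folded xu_def]
  have "TL_e v n i (mu v \<alpha>) = (- (v + inverse v)) *\<^sub>v mu v \<alpha>" if w: "w = 0" and ab: "a * b = -1"
  proof -
    have ab: "a = 1" "b = -1" using sets(3,4) ab w0(2) w by auto
    have "F_tensor v m x = 0"
      using F_power_mu_eq_0[OF assms(1) one(1)] w assms(9) by (simp add: x_def m_def)
    then have "\<Phi>\<^sub>2 v (Suc m) (w + 1) (\<Phi>\<^sub>1 x) = (- 1) *\<^sub>v xu"
      unfolding \<Phi>\<^sub>2_\<Phi>\<^sub>1_expand[OF assms(1) x w0(1)]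
      by (simp add: w xu_def qint_def tensor_linear) (simp add: pointwise)
    moreover have "qint v (w + 2) = v + inverse v"
      using assms(1) by (simp add: w qint_def numeral_2_eq_2 power_int_minus)
    ultimately have "TL_e v (Suc (Suc m)) (Suc m) (mu v (\<alpha>' @ [a, b]))
        = 0 *\<^sub>v mu v (\<alpha>' @ [a, b]) + (- (v + inverse v)) *\<^sub>v mu v (\<alpha>' @ [a, b])"
      unfolding ab mu2 e21 by (simp add: pointwise algebra_simps)
    from extend[OF this] show ?thesis by simp
  qed
  moreover have "TL_e v n i (mu v \<alpha>)
        = (qint v (w + 2) / qint v (w + 1)) *\<^sub>v (mu v \<beta> - mu v \<alpha>)" if ab: "a = 1" "b = -1"
  proof -
    define c where "c = qint v (w + 2) / qint v (w + 1)"
    have "TL_e v (Suc (Suc m)) (Suc m) (mu v (\<alpha>' @ [a, b]))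
        = c *\<^sub>v (mu v (\<alpha>' @ [-1, 1]) - mu v (\<alpha>' @ [a, b]))"
      unfolding ab mu2 e21 diff using q by (auto simp: c_def pointwise)
    also have "\<dots> = c *\<^sub>v mu v (\<alpha>' @ [-1, 1]) + (- c) *\<^sub>v mu v (\<alpha>' @ [a, b])"
      by (auto simp: pointwise algebra_simps)
    finally have "TL_e v n i (mu v \<alpha>) = c *\<^sub>v mu v \<beta> + (- c) *\<^sub>v mu v \<alpha>"
      using extend[of c "-1" 1 "- c"] assms(10) ab by simp
    then show ?thesis
      unfolding c_def[symmetric] by (simp add: pointwise algebra_simps)
  qed
  moreover have "TL_e v n i (mu v \<alpha>)
        = (qint v w / qint v (w + 1)) *\<^sub>v (mu v \<beta> - mu v \<alpha>)" if ab: "a = -1" "b = 1"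
  proof -
    define c where "c = qint v w / qint v (w + 1)"
    have diff': "\<Phi>\<^sub>2 v (Suc m) (w + 1) (\<Phi>\<^sub>1 x) - \<Phi>\<^sub>1 (\<Phi>\<^sub>2 v m w x) = (- qint v (w + 1)) *\<^sub>v xu"
      using diff by (auto simp: pointwise algebra_simps)
    have "TL_e v (Suc (Suc m)) (Suc m) (mu v (\<alpha>' @ [a, b]))
        = c *\<^sub>v (mu v (\<alpha>' @ [1, -1]) - mu v (\<alpha>' @ [a, b]))"
      unfolding ab mu2 e12 diff' using q by (auto simp: c_def pointwise)
    also have "\<dots> = c *\<^sub>v mu v (\<alpha>' @ [1, -1]) + (- c) *\<^sub>v mu v (\<alpha>' @ [a, b])"
      by (auto simp: pointwise algebra_simps)
    finally have "TL_e v n i (mu v \<alpha>) = c *\<^sub>v mu v \<beta> + (- c) *\<^sub>v mu v \<alpha>"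
      using extend[of c 1 "-1" "- c"] assms(10) ab by simp
    then show ?thesis
      unfolding c_def[symmetric] by (simp add: pointwise algebra_simps)
  qed
  moreover have "TL_e v n i (mu v \<alpha>) = 0" if "a = b" "0 < w"
  proof -
    have "TL_e v (Suc (Suc m)) (Suc m) (mu v (\<alpha>' @ [a, b])) = 0"
      using sets(3) that TL_e_\<Phi>\<^sub>1_\<Phi>\<^sub>1[OF assms(1) x w0(1)] TL_e_\<Phi>\<^sub>2_\<Phi>\<^sub>2[OF assms(1) x w0(1)]
      by (auto simp: mu2)
    then show ?thesis using extend[of 0 a b 0] by simp
  qed
  ultimately show ?thesis using sets(3,4) by auto
qed

end
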